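(* Let $a\in\mathbb{R}$, $a^+=\max\{a,0\}$, $a^-=\min\{a,0\}$, and let $\tau<-\tfrac12$. Consider the advection problem $\partial_t u+a\,\partial_x u=0$ on $0\le x\le 1$, $t>0$, with initial condition $u(x,0)=u_{in}(x)$ and prescribed boundary data $b$ at the inflow boundary, that is, $u(0,t)=b_0(t)$ if $a>0$ and $u(1,t)=b_N(t)$ if $a<0$. Approximate it by the continuous Galerkin method with weakly imposed boundary condition: $u^h(x,t)=\sum_{j=0}^N u^h_j(t)\varphi_j(x)$, where the coefficients satisfy, for $i=0,\dots,N$ and $t>0$, $$\sum_{j=0}^N M_{i,j}\,\frac{d}{dt}u^h_j(t)+a\sum_{j=0}^N Q_{i,j}\,u^h_j(t)=\tau a^+\big(u^h(0,t)-b_0(t)\big)\varphi_i(0)-\tau a^-\big(u^h(1,t)-b_N(t)\big)\varphi_i(1),$$ with initial values $\underline{u}(0)=\underline{u}_{in}$. Here the basis functions $\varphi_j$ and the matrices $M,Q$ are those described in the context. Then the method is strongly energy stable: there is a function $K(t)$, bounded for any finite $t$ and independent of $u_{in}$, of $b$ and of the mesh, such that for all $t>0$ $$\|\underline{u}(t)\|_{M}^2\le K(t)\Big(\|\underline{u}_{in}\|_{M}^2+\max_{t_1\in[0,t]}|b(t_1)|^2\Big),$$ where $b(t)$ denotes the inflow boundary datum ($b_0(t)$ if $a>0$, $b_N(t)$ if $a<0$).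
   Context: Grid and basis: $0=x_0<x_1<\dots<x_N=1$ are the degrees of freedom (nodes) of a finite element mesh of $I=[0,1]$. The functions $\varphi_0,\dots,\varphi_N$ are the continuous (over element interfaces), piecewise polynomial Lagrange basis functions associated with these nodes, so $\varphi_i(x_j)=\delta_{ij}$. In particular, both boundary points are degrees of freedom and $u^h(0,t)=u^h_0(t)$, $u^h(1,t)=u^h_N(t)$. Matrices: $M_{i,j}=\int_I\varphi_j(x)\varphi_i(x)\,dx$ and $Q_{i,j}=\int_I\varphi_j'(x)\varphi_i(x)\,dx$. The integrals are evaluated exactly, or by a quadrature rule for which $M$ is symmetric positive definite and the summation-by-parts (SBP) property $Q+Q^T=\operatorname{diag}(-1,0,\dots,0,1)$ holds. For exact integration these properties hold automatically. Notation: $\underline{u}(t)=(u^h_0(t),\dots,u^h_N(t))^T$ is the coefficient vector, $\underline{u}_{in}$ is the vector of nodal values of $u_{in}$, and $\|\underline{u}\|_M^2=\underline{u}^TM\underline{u}$. Boundary data is only prescribed at the inflow boundary. At the other end point the corresponding penalty term vanishes, because $a^-=0$ if $a\ge0$ and $a^+=0$ if $a\le 0$. *)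

theory Defs
  imports "HOL-Analysis.Analysis" "HOL-Computational_Algebra.Polynomial"
begin

(* The nodes are x 0 < ... < x N. Element k < m is spanned by the consecutive nodes
   x (e k), ..., x (e (Suc k)); its two end nodes are the element interfaces. *)
definition fe_mesh :: "nat \<Rightarrow> (nat \<Rightarrow> real) \<Rightarrow> nat \<Rightarrow> (nat \<Rightarrow> nat) \<Rightarrow> bool" where
  "fe_mesh N x m e \<longleftrightarrow>
     strict_mono_on {..N} x \<and> x 0 = 0 \<and> x N = 1 \<and>
     strict_mono_on {..m} e \<and> e 0 = 0 \<and> e m = N"

definition fe_element :: "(nat \<Rightarrow> real) \<Rightarrow> (nat \<Rightarrow> nat) \<Rightarrow> nat \<Rightarrow> real set" where
  "fe_element x e k = {x (e k)..x (e (Suc k))}"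

(* Element k carries e (Suc k) - e k + 1 nodes, hence the degree bound.
   Nothing is said about the values of the basis functions outside [0,1]. *)
definition lagrange_basis ::
  "nat \<Rightarrow> (nat \<Rightarrow> real) \<Rightarrow> nat \<Rightarrow> (nat \<Rightarrow> nat) \<Rightarrow> (nat \<Rightarrow> real \<Rightarrow> real) \<Rightarrow> bool" where
  "lagrange_basis N x m e \<phi> \<longleftrightarrow>
     (\<forall>i\<le>N. continuous_on {0..1} (\<phi> i) \<and>
            (\<forall>k<m. \<exists>p::real poly. degree p \<le> e (Suc k) - e k \<and>
                     (\<forall>y\<in>fe_element x e k. \<phi> i y = poly p y)) \<and>
            (\<forall>j\<le>N. \<phi> i (x j) = (if i = j then 1 else 0)))"

(* The derivative of a basis function need not exist at the element interfaces and at
   0 and 1, where deriv has an arbitrary value; these finitely many points do not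
   influence the integral. *)
definition exact_matrices ::
  "nat \<Rightarrow> (nat \<Rightarrow> real \<Rightarrow> real) \<Rightarrow> (nat \<Rightarrow> nat \<Rightarrow> real) \<Rightarrow> (nat \<Rightarrow> nat \<Rightarrow> real) \<Rightarrow> bool" where
  "exact_matrices N \<phi> M Q \<longleftrightarrow>
     (\<forall>i\<le>N. \<forall>j\<le>N. M i j = integral {0..1} (\<lambda>y. \<phi> j y * \<phi> i y) \<and>
                   Q i j = integral {0..1} (\<lambda>y. deriv (\<phi> j) y * \<phi> i y))"

(* Elementwise quadrature with points \<xi> k q and weights w k q (q < n k) on element k.
   Quadrature points may lie on element interfaces, where the derivatives taken in the
   two adjacent elements differ; so the integrand F k depends on the element. *)
definition quadrature ::
  "nat \<Rightarrow> (nat \<Rightarrow> nat) \<Rightarrow> (nat \<Rightarrow> nat \<Rightarrow> real) \<Rightarrow> (nat \<Rightarrow> nat \<Rightarrow> real) \<Rightarrow> (nat \<Rightarrow> real \<Rightarrow> real) \<Rightarrow> real"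
where
  "quadrature m n \<xi> w F = (\<Sum>k<m. \<Sum>q<n k. w k q * F k (\<xi> k q))"

definition quadrature_matrices ::
  "nat \<Rightarrow> (nat \<Rightarrow> real) \<Rightarrow> nat \<Rightarrow> (nat \<Rightarrow> nat) \<Rightarrow> (nat \<Rightarrow> real \<Rightarrow> real) \<Rightarrow>
   (nat \<Rightarrow> nat \<Rightarrow> real) \<Rightarrow> (nat \<Rightarrow> nat \<Rightarrow> real) \<Rightarrow> bool" where
  "quadrature_matrices N x m e \<phi> M Q \<longleftrightarrow>
     (\<exists>n \<xi> w. (\<forall>k<m. \<forall>q<n k. \<xi> k q \<in> fe_element x e k) \<and>
        (\<forall>i\<le>N. \<forall>j\<le>N.
           M i j = quadrature m n \<xi> w (\<lambda>k y. \<phi> j y * \<phi> i y) \<and>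
           Q i j = quadrature m n \<xi> w
                     (\<lambda>k y. vector_derivative (\<phi> j) (at y within fe_element x e k) * \<phi> i y)))"

(* The quadratic form v^T A v; for A = M this is the squared M-norm. *)
definition quad_form :: "nat \<Rightarrow> (nat \<Rightarrow> nat \<Rightarrow> real) \<Rightarrow> (nat \<Rightarrow> real) \<Rightarrow> real" where
  "quad_form N A v = (\<Sum>i\<le>N. \<Sum>j\<le>N. v i * A i j * v j)"

definition sym_pos_def :: "nat \<Rightarrow> (nat \<Rightarrow> nat \<Rightarrow> real) \<Rightarrow> bool" where
  "sym_pos_def N A \<longleftrightarrow>
     (\<forall>i\<le>N. \<forall>j\<le>N. A i j = A j i) \<and>
     (\<forall>v. (\<exists>i\<le>N. v i \<noteq> 0) \<longrightarrow> quad_form N A v > 0)"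

definition sbp :: "nat \<Rightarrow> (nat \<Rightarrow> nat \<Rightarrow> real) \<Rightarrow> bool" where
  "sbp N Q \<longleftrightarrow>
     (\<forall>i\<le>N. \<forall>j\<le>N. Q i j + Q j i =
        (if i = 0 \<and> j = 0 then - 1 else if i = N \<and> j = N then 1 else 0))"

definition cg_matrices ::
  "nat \<Rightarrow> (nat \<Rightarrow> real) \<Rightarrow> nat \<Rightarrow> (nat \<Rightarrow> nat) \<Rightarrow> (nat \<Rightarrow> real \<Rightarrow> real) \<Rightarrow>
   (nat \<Rightarrow> nat \<Rightarrow> real) \<Rightarrow> (nat \<Rightarrow> nat \<Rightarrow> real) \<Rightarrow> bool" where
  "cg_matrices N x m e \<phi> M Q \<longleftrightarrow>
     exact_matrices N \<phi> M Q \<or>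
     (quadrature_matrices N x m e \<phi> M Q \<and> sym_pos_def N M \<and> sbp N Q)"

definition fe_function ::
  "nat \<Rightarrow> (nat \<Rightarrow> real \<Rightarrow> real) \<Rightarrow> (nat \<Rightarrow> real \<Rightarrow> real) \<Rightarrow> real \<Rightarrow> real \<Rightarrow> real" where
  "fe_function N \<phi> u y t = (\<Sum>j\<le>N. u j t * \<phi> j y)"

(* u j t is the j-th coefficient at time t. The differential equations hold for t > 0 only;
   continuity on [0, \<infinity>) is what links them to the initial values. *)
definition cg_solution ::
  "real \<Rightarrow> real \<Rightarrow> nat \<Rightarrow> (nat \<Rightarrow> real) \<Rightarrow> (nat \<Rightarrow> real \<Rightarrow> real) \<Rightarrow>
   (nat \<Rightarrow> nat \<Rightarrow> real) \<Rightarrow> (nat \<Rightarrow> nat \<Rightarrow> real) \<Rightarrow>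
   (real \<Rightarrow> real) \<Rightarrow> (real \<Rightarrow> real) \<Rightarrow> (real \<Rightarrow> real) \<Rightarrow> (nat \<Rightarrow> real \<Rightarrow> real) \<Rightarrow> bool" where
  "cg_solution a \<tau> N x \<phi> M Q b0 bN u_in u \<longleftrightarrow>
     (\<forall>j\<le>N. continuous_on {0..} (u j) \<and> u j 0 = u_in (x j) \<and>
            (\<forall>t>0. u j field_differentiable (at t))) \<and>
     (\<forall>i\<le>N. \<forall>t>0.
        (\<Sum>j\<le>N. M i j * deriv (u j) t) + a * (\<Sum>j\<le>N. Q i j * u j t) =
          \<tau> * max a 0 * (fe_function N \<phi> u 0 t - b0 t) * \<phi> i 0
          - \<tau> * min a 0 * (fe_function N \<phi> u 1 t - bN t) * \<phi> i 1)"

(* For a = 0 there is no inflow boundary; the datum is then taken to be 0, which makes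
   the energy estimate as strong as possible. *)
definition inflow_datum :: "real \<Rightarrow> (real \<Rightarrow> real) \<Rightarrow> (real \<Rightarrow> real) \<Rightarrow> real \<Rightarrow> real" where
  "inflow_datum a b0 bN = (if a > 0 then b0 else if a < 0 then bN else (\<lambda>t. 0))"

end

theory Submission imports Defs
begin

text \<open>Testing the scheme with the solution itself makes the energy \<open>E = u\<^sup>T M u\<close> appear on the
  left-hand side, while the SBP property turns the advection term into the boundary terms
  \<open>a (u\<^sub>N\<^sup>2 - u\<^sub>0\<^sup>2) / 2\<close>. At the inflow boundary, with \<open>v\<close> the boundary value and \<open>d\<close> the datum,
  \<open>(1 + 2 \<tau>) v\<^sup>2 - 2 \<tau> d v \<le> \<tau>\<^sup>2 d\<^sup>2 / (- (1 + 2 \<tau>))\<close> because \<open>1 + 2 \<tau> < 0\<close>; hence \<open>E'\<close> is at most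
  \<open>\<bar>a\<bar> \<tau>\<^sup>2 / (- (1 + 2 \<tau>))\<close> times the squared datum.\<close>

section \<open>Scalar estimates for the boundary terms\<close>

lemma inflow_boundary_bound:
  fixes \<tau> d v :: real
  assumes "\<tau> < - 1 / 2"
  shows "(1 + 2 * \<tau>) * v\<^sup>2 - 2 * \<tau> * d * v \<le> \<tau>\<^sup>2 / (- (1 + 2 * \<tau>)) * d\<^sup>2"
proof -
  define r where "r = - (1 + 2 * \<tau>)"
  have r: "r > 0" using assms by (simp add: r_def)
  \<comment> \<open>Completing the square in \<open>v\<close>: after division by \<open>r\<close>,
    the factor of \<open>v\<^sup>2\<close> is \<open>r\<close> and that of \<open>d\<^sup>2\<close>
    is \<open>\<tau>\<^sup>2 / r\<close>, the constant of the bound.\<close>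
  have "0 \<le> (r * v + \<tau> * d)\<^sup>2 / r" using r by simp
  also have "(r * v + \<tau> * d)\<^sup>2 / r = r * v\<^sup>2 + 2 * \<tau> * d * v + \<tau>\<^sup>2 / r * d\<^sup>2"
    using r by (simp add: field_simps power2_eq_square)
  finally have "(- r) * v\<^sup>2 - 2 * \<tau> * d * v \<le> \<tau>\<^sup>2 / r * d\<^sup>2" by simp
  then show ?thesis unfolding r_def by (simp only: minus_minus)
qed

text \<open>The left-hand side is the energy rate, with \<open>v\<close> and \<open>w\<close> the
  boundary values at 0 and 1. The inflow end is controlled by \<open>inflow_boundary_bound\<close>
  scaled by \<open>\<bar>a\<bar>\<close>; the outflow end contributes only a term of favourable
  sign. For \<open>a = 0\<close> both sides vanish.\<close>

lemma energy_rate_bound: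
  fixes a \<tau> v w d0 dN :: real
  assumes "\<tau> < - 1 / 2"
  shows "2 * (\<tau> * max a 0 * (v - d0) * v - \<tau> * min a 0 * (w - dN) * w) - a * (w\<^sup>2 - v\<^sup>2)
    \<le> \<bar>a\<bar> * (\<tau>\<^sup>2 / (- (1 + 2 * \<tau>)) * (if a > 0 then d0 else if a < 0 then dN else 0)\<^sup>2)"
proof (cases a "0 :: real" rule: linorder_cases)
  case less
  have "- a * ((1 + 2 * \<tau>) * w\<^sup>2 - 2 * \<tau> * dN * w) \<le> - a * (\<tau>\<^sup>2 / (- (1 + 2 * \<tau>)) * dN\<^sup>2)"
    using inflow_boundary_bound[OF assms] less by (intro mult_left_mono) auto
  moreover have "a * v\<^sup>2 \<le> 0" using less by (simp add: mult_le_0_iff)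
  moreover have "2 * (\<tau> * max a 0 * (v - d0) * v - \<tau> * min a 0 * (w - dN) * w) - a * (w\<^sup>2 - v\<^sup>2)
      = - a * ((1 + 2 * \<tau>) * w\<^sup>2 - 2 * \<tau> * dN * w) + a * v\<^sup>2"
    using less by (simp add: min_def max_def algebra_simps power2_eq_square)
  moreover have "\<bar>a\<bar> * (\<tau>\<^sup>2 / (- (1 + 2 * \<tau>)) * (if a > 0 then d0 else if a < 0 then dN else 0)\<^sup>2)
      = - a * (\<tau>\<^sup>2 / (- (1 + 2 * \<tau>)) * dN\<^sup>2)"
    using less by simp
  ultimately show ?thesis by linarith
next
  case equal
  then show ?thesis by simp
next
  case greater
  have "a * ((1 + 2 * \<tau>) * v\<^sup>2 - 2 * \<tau> * d0 * v) \<le> a * (\<tau>\<^sup>2 / (- (1 + 2 * \<tau>)) * d0\<^sup>2)"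
    using inflow_boundary_bound[OF assms] greater by (intro mult_left_mono) auto
  moreover have "0 \<le> a * w\<^sup>2" using greater by simp
  moreover have "2 * (\<tau> * max a 0 * (v - d0) * v - \<tau> * min a 0 * (w - dN) * w) - a * (w\<^sup>2 - v\<^sup>2)
      = a * ((1 + 2 * \<tau>) * v\<^sup>2 - 2 * \<tau> * d0 * v) - a * w\<^sup>2"
    using greater by (simp add: min_def max_def algebra_simps power2_eq_square)
  moreover have "\<bar>a\<bar> * (\<tau>\<^sup>2 / (- (1 + 2 * \<tau>)) * (if a > 0 then d0 else if a < 0 then dN else 0)\<^sup>2)
      = a * (\<tau>\<^sup>2 / (- (1 + 2 * \<tau>)) * d0\<^sup>2)"
    using greater by simp
  ultimately show ?thesis by linarith
qed

section \<open>Derivative of the energy and the SBP identity\<close>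

lemma quad_form_has_derivative:
  assumes sym: "\<And>i j. i \<le> N \<Longrightarrow> j \<le> N \<Longrightarrow> M i j = M j i"
    and der: "\<And>j. j \<le> N \<Longrightarrow> (u j has_real_derivative u' j) (at t)"
  shows "((\<lambda>t. quad_form N M (\<lambda>j. u j t)) has_real_derivative
    2 * (\<Sum>i\<le>N. u i t * (\<Sum>j\<le>N. M i j * u' j))) (at t)"
proof -
  have "((\<lambda>t. quad_form N M (\<lambda>j. u j t)) has_real_derivative
      (\<Sum>i\<le>N. \<Sum>j\<le>N. u' i * M i j * u j t + u i t * M i j * u' j)) (at t)"
    unfolding quad_form_def
    by (intro DERIV_sum) (auto intro!: derivative_eq_intros der simp: algebra_simps)
  \<comment> \<open>Symmetry of \<open>M\<close> makes the two product-rule contributions equal;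
    hence the factor 2.\<close>
  moreover have "(\<Sum>i\<le>N. \<Sum>j\<le>N. u' i * M i j * u j t) = (\<Sum>i\<le>N. \<Sum>j\<le>N. u i t * M i j * u' j)"
    by (subst sum.swap) (auto intro!: sum.cong simp: sym)
  ultimately show ?thesis
    by (simp add: sum.distrib sum_distrib_left mult.assoc)
qed

text \<open>Transposing \<open>Q\<close> does not change its quadratic form, so twice the form sees
  only \<open>Q + Q^T\<close>. The condition \<open>0 < N\<close> keeps the two corner entries
  apart: for \<open>N = 0\<close> the first branch of \<open>sbp\<close> would hide the
  second.\<close>

lemma quad_form_sbp:
  assumes "sbp N Q" and "0 < N"
  shows "2 * quad_form N Q v = (v N)\<^sup>2 - (v 0)\<^sup>2"
proof -
  have "2 * quad_form N Q v = (\<Sum>i\<le>N. \<Sum>j\<le>N. v i * Q i j * v j) + (\<Sum>i\<le>N. \<Sum>j\<le>N. v j * Q j i * v i)"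
    unfolding quad_form_def by (subst (3) sum.swap) simp
  also have "\<dots> = (\<Sum>i\<le>N. \<Sum>j\<le>N. v i * (Q i j + Q j i) * v j)"
    by (simp add: sum.distrib[symmetric] algebra_simps)
  \<comment> \<open>Written with the test \<open>j = i\<close> and a difference of two deltas, both
    sums collapse by simplification.\<close>
  also have "\<dots> = (\<Sum>i\<le>N. \<Sum>j\<le>N. (if j = i then (if i = N then (v N)\<^sup>2 else 0) - (if i = 0 then (v 0)\<^sup>2 else 0) else 0))"
    using assms by (intro sum.cong refl) (auto simp: sbp_def power2_eq_square)
  also have "\<dots> = (v N)\<^sup>2 - (v 0)\<^sup>2"
    by (simp add: sum_subtractf)
  finally show ?thesis .
qed

section \<open>Summation by parts for exact integration\<close>

text \<open>On a single element this is the fundamental theorem for the product of two polynomials.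
  Integrability of one summand is recorded as well, since the integral of the sum must later be
  split.\<close>

lemma element_derivative_integrals:
  fixes f g :: "real \<Rightarrow> real"
  assumes "c < d"
    and f: "\<And>y. y \<in> {c..d} \<Longrightarrow> f y = poly p y"
    and g: "\<And>y. y \<in> {c..d} \<Longrightarrow> g y = poly q y"
  shows "(\<lambda>y. deriv f y * g y) integrable_on {c..d}"
    and "((\<lambda>y. deriv f y * g y + deriv g y * f y) has_integral f d * g d - f c * g c) {c..d}"
proof -
  \<comment> \<open>\<open>deriv\<close> depends on a full neighbourhood, but the polynomial
    representation is known only on the closed element. The end points are therefore excluded; being
    finitely many, they do not affect the integrals.\<close>
  have deriv_eq: "deriv h y = poly (pderiv r) y"
    if "\<And>y. y \<in> {c..d} \<Longrightarrow> h y = poly r y" and "y \<in> {c..d} - {c, d}" for h :: "real \<Rightarrow> real" and r y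
  proof (rule DERIV_imp_deriv)
    show "(h has_real_derivative poly (pderiv r) y) (at y)"
      by (rule has_field_derivative_transform_within_open[OF poly_DERIV, where S = "{c<..<d}"])
        (use that in auto)
  qed
  have df: "deriv f y = poly (pderiv p) y" and dg: "deriv g y = poly (pderiv q) y"
    if "y \<in> {c..d} - {c, d}" for y
    using deriv_eq f g that by blast+
  show "(\<lambda>y. deriv f y * g y) integrable_on {c..d}"
    by (rule integrable_spike_finite[of "{c, d}" _ _ "\<lambda>y. poly (pderiv p) y * poly q y"])
      (auto simp: df g intro!: integrable_continuous_interval continuous_intros)
  have "((\<lambda>y. poly (pderiv p) y * poly q y + poly (pderiv q) y * poly p y) has_integral
      poly p d * poly q d - poly p c * poly q c) {c..d}"
  proof (rule fundamental_theorem_of_calculus)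
    fix y
    show "((\<lambda>y. poly p y * poly q y) has_vector_derivative
        poly (pderiv p) y * poly q y + poly (pderiv q) y * poly p y) (at y within {c..d})"
      unfolding has_real_derivative_iff_has_vector_derivative[symmetric]
      by (auto intro!: derivative_eq_intros)
  qed (use assms in simp)
  then have "((\<lambda>y. deriv f y * g y + deriv g y * f y) has_integral
      poly p d * poly q d - poly p c * poly q c) {c..d}"
    by (rule has_integral_spike_finite[of "{c, d}", rotated 2]) (auto simp: df dg f g)
  then show "((\<lambda>y. deriv f y * g y + deriv g y * f y) has_integral f d * g d - f c * g c) {c..d}"
    using assms by simp
qed

text \<open>Induction over the elements, integrating up to the interface \<open>x (e k)\<close>.
  Boundary terms at inner interfaces telescope, because adjacent elements share the value of each
  basis function there.\<close>

lemma mesh_derivative_integrals: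
  assumes mesh: "fe_mesh N x m e"
    and basis: "lagrange_basis N x m e \<phi>"
    and ij: "i \<le> N" "j \<le> N"
    and "k \<le> m"
  shows "(\<lambda>y. deriv (\<phi> i) y * \<phi> j y) integrable_on {0..x (e k)} \<and>
    ((\<lambda>y. deriv (\<phi> i) y * \<phi> j y + deriv (\<phi> j) y * \<phi> i y) has_integral
      \<phi> i (x (e k)) * \<phi> j (x (e k)) - \<phi> i 0 * \<phi> j 0) {0..x (e k)}"
  using \<open>k \<le> m\<close>
proof (induction k)
  case 0
  then show ?case using mesh by (auto simp: fe_mesh_def has_integral_refl intro: has_integral_integrable)
next
  case (Suc k)
  have em: "strict_mono_on {..m} e" and xm: "strict_mono_on {..N} x" and "x 0 = 0" "e m = N"
    using mesh by (auto simp: fe_mesh_def)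
  have ek: "e k < e (Suc k)" using strict_mono_onD[OF em] Suc.prems by simp
  have eN: "e (Suc k) \<le> N"
    using strict_mono_on_imp_mono_on[OF em] Suc.prems \<open>e m = N\<close> by (metis atMost_iff mono_onD order_refl)
  have lt: "x (e k) < x (e (Suc k))" using strict_mono_onD[OF xm] ek eN by simp
  have ge: "0 \<le> x (e k)"
    using strict_mono_on_imp_mono_on[OF xm] ek eN \<open>x 0 = 0\<close>
    by (metis atMost_iff less_imp_le_nat mono_onD order_trans zero_le)
  have poly: "\<exists>p. \<forall>y\<in>{x (e k)..x (e (Suc k))}. \<phi> l y = poly p y" if "l \<le> N" for l
    using basis that Suc_le_lessD[OF Suc.prems] unfolding lagrange_basis_def fe_element_def by blast
  obtain p where p: "\<And>y. y \<in> {x (e k)..x (e (Suc k))} \<Longrightarrow> \<phi> i y = poly p y"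
    using poly[OF ij(1)] by blast
  obtain q where q: "\<And>y. y \<in> {x (e k)..x (e (Suc k))} \<Longrightarrow> \<phi> j y = poly q y"
    using poly[OF ij(2)] by blast
  note el = element_derivative_integrals[OF lt p q]
  show ?case
  proof
    show "(\<lambda>y. deriv (\<phi> i) y * \<phi> j y) integrable_on {0..x (e (Suc k))}"
      by (rule Henstock_Kurzweil_Integration.integrable_combine[where c = "x (e k)"]) (use ge lt el Suc in auto)
    show "((\<lambda>y. deriv (\<phi> i) y * \<phi> j y + deriv (\<phi> j) y * \<phi> i y) has_integral
        \<phi> i (x (e (Suc k))) * \<phi> j (x (e (Suc k))) - \<phi> i 0 * \<phi> j 0) {0..x (e (Suc k))}"
      using has_integral_combine[OF ge less_imp_le[OF lt] conjunct2[OF Suc.IH] el(2)] Suc.prems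
      by simp
  qed
qed

lemma sbp_exact_matrices:
  assumes mesh: "fe_mesh N x m e"
    and basis: "lagrange_basis N x m e \<phi>"
    and "exact_matrices N \<phi> M Q"
  shows "sbp N Q"
  unfolding sbp_def
proof (intro allI impI)
  fix i j assume ij: "i \<le> N" "j \<le> N"
  have x: "x 0 = 0" "x N = 1" "e m = N" using mesh by (auto simp: fe_mesh_def)
  \<comment> \<open>The end points 0 and 1 are different nodes, so the cases \<open>i = 0\<close>
    and \<open>i = N\<close> cannot coincide.\<close>
  then have "N \<noteq> 0" by (metis zero_neq_one)
  have \<phi>: "\<phi> l (x k) = (if l = k then 1 else 0)" if "l \<le> N" "k \<le> N" for l k
    using basis that by (simp add: lagrange_basis_def)
  \<comment> \<open>With \<open>k = m\<close> the integrals extend over the whole interval, as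
    \<open>x (e m) = x N = 1\<close>.\<close>
  note I = mesh_derivative_integrals[OF mesh basis _ _ order_refl, unfolded x]
  have "Q i j + Q j i = integral {0..1} (\<lambda>y. deriv (\<phi> j) y * \<phi> i y) + integral {0..1} (\<lambda>y. deriv (\<phi> i) y * \<phi> j y)"
    using assms ij by (simp add: exact_matrices_def)
  also have "\<dots> = integral {0..1} (\<lambda>y. deriv (\<phi> j) y * \<phi> i y + deriv (\<phi> i) y * \<phi> j y)"
    using I ij by (subst Henstock_Kurzweil_Integration.integral_add) auto
  also have "\<dots> = \<phi> j 1 * \<phi> i 1 - \<phi> j 0 * \<phi> i 0"
    using I ij by (intro integral_unique) auto
  also have "\<dots> = (if i = 0 \<and> j = 0 then - 1 else if i = N \<and> j = N then 1 else 0)"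
    using \<phi>[of i 0] \<phi>[of j 0] \<phi>[of i N] \<phi>[of j N] ij x \<open>N \<noteq> 0\<close> by auto
  finally show "Q i j + Q j i = (if i = 0 \<and> j = 0 then - 1 else if i = N \<and> j = N then 1 else 0)" .
qed

section \<open>Matrix properties shared by exact integration and quadrature\<close>

text \<open>The form is the integral of the square of the finite element function with coefficients
  \<open>v\<close>.\<close>

lemma exact_mass_matrix_nonneg:
  assumes basis: "lagrange_basis N x m e \<phi>"
    and exact: "exact_matrices N \<phi> M Q"
  shows "0 \<le> quad_form N M v"
proof -
  have cont: "continuous_on {0..1} (\<phi> i)" if "i \<le> N" for i
    using basis that by (simp add: lagrange_basis_def)
  have int: "(\<lambda>y. v i * (\<phi> j y * \<phi> i y) * v j) integrable_on {0..1}" if "i \<le> N" "j \<le> N" for i j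
    using that by (intro integrable_continuous_interval continuous_intros cont)
  have "quad_form N M v = (\<Sum>i\<le>N. \<Sum>j\<le>N. integral {0..1} (\<lambda>y. v i * (\<phi> j y * \<phi> i y) * v j))"
    using exact by (simp add: quad_form_def exact_matrices_def)
  also have "\<dots> = (\<Sum>i\<le>N. integral {0..1} (\<lambda>y. \<Sum>j\<le>N. v i * (\<phi> j y * \<phi> i y) * v j))"
    by (intro sum.cong refl Henstock_Kurzweil_Integration.integral_sum[symmetric] int) auto
  also have "\<dots> = integral {0..1} (\<lambda>y. \<Sum>i\<le>N. \<Sum>j\<le>N. v i * (\<phi> j y * \<phi> i y) * v j)"
    by (intro Henstock_Kurzweil_Integration.integral_sum[symmetric] integrable_sum int) auto
  also have "\<dots> = integral {0..1} (\<lambda>y. (\<Sum>i\<le>N. v i * \<phi> i y)\<^sup>2)"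
    by (simp add: power2_eq_square sum_product mult_ac)
  also have "\<dots> \<ge> 0"
    by (intro Henstock_Kurzweil_Integration.integral_nonneg integrable_continuous_interval
        continuous_intros cont) auto
  finally show ?thesis .
qed

text \<open>The common interface to both ways of evaluating the integrals: derived for exact
  matrices, read off from the assumptions for quadrature.\<close>

lemma cg_matrices_properties:
  assumes "fe_mesh N x m e" and "lagrange_basis N x m e \<phi>" and "cg_matrices N x m e \<phi> M Q"
  shows "sbp N Q"
    and "\<And>i j. i \<le> N \<Longrightarrow> j \<le> N \<Longrightarrow> M i j = M j i"
    and "\<And>v. 0 \<le> quad_form N M v"
proof -
  have "sbp N Q \<and> (\<forall>i\<le>N. \<forall>j\<le>N. M i j = M j i) \<and> (\<forall>v. 0 \<le> quad_form N M v)"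
    using assms(3) unfolding cg_matrices_def
  proof (elim disjE conjE)
    assume "exact_matrices N \<phi> M Q"
    then show ?thesis
      using sbp_exact_matrices[OF assms(1,2)] exact_mass_matrix_nonneg[OF assms(2)]
      by (auto simp: exact_matrices_def mult.commute)
  next
    assume "sym_pos_def N M" "sbp N Q"
    \<comment> \<open>Strict positivity covers only vectors with a nonzero entry up to index
      \<open>N\<close>; for the others the form is 0.\<close>
    moreover have "0 \<le> quad_form N M v" for v
    proof (cases "\<exists>i\<le>N. v i \<noteq> 0")
      case True
      then show ?thesis using \<open>sym_pos_def N M\<close> by (auto simp: sym_pos_def_def less_imp_le)
    next
      case False
      then show ?thesis by (simp add: quad_form_def)
    qed
    ultimately show ?thesis by (simp add: sym_pos_def_def)
  qed
  then show "sbp N Q" "\<And>i j. i \<le> N \<Longrightarrow> j \<le> N \<Longrightarrow> M i j = M j i" "\<And>v. 0 \<le> quad_form N M v"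
    by auto
qed

section \<open>Energy balance and growth in time\<close>

lemma energy_has_derivative:
  assumes mesh: "fe_mesh N x m e"
    and basis: "lagrange_basis N x m e \<phi>"
    and mat: "cg_matrices N x m e \<phi> M Q"
    and sol: "cg_solution a \<tau> N x \<phi> M Q b0 bN u_in u"
    and "0 < t"
  shows "((\<lambda>t. quad_form N M (\<lambda>j. u j t)) has_real_derivative
    2 * (\<tau> * max a 0 * (u 0 t - b0 t) * u 0 t - \<tau> * min a 0 * (u N t - bN t) * u N t)
    - a * ((u N t)\<^sup>2 - (u 0 t)\<^sup>2)) (at t)"
proof -
  have x: "x 0 = 0" "x N = 1" using mesh by (auto simp: fe_mesh_def)
  then have "N \<noteq> 0" by (metis zero_neq_one)
  have \<phi>: "\<phi> i (x k) = (if i = k then 1 else 0)" if "i \<le> N" "k \<le> N" for i k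
    using basis that by (simp add: lagrange_basis_def)
  have \<phi>0: "\<phi> i 0 = (if i = 0 then 1 else 0)" and \<phi>1: "\<phi> i 1 = (if i = N then 1 else 0)"
    if "i \<le> N" for i
    using \<phi>[of i 0] \<phi>[of i N] that x by simp_all
  \<comment> \<open>Both boundary points are nodes, so the discrete solution takes its first and
    last coefficients there.\<close>
  have f0: "fe_function N \<phi> u 0 t = u 0 t" and f1: "fe_function N \<phi> u 1 t = u N t"
    by (simp_all add: fe_function_def \<phi>0 \<phi>1 if_distrib cong: if_cong)
  have scheme: "(\<Sum>j\<le>N. M i j * deriv (u j) t) =
      \<tau> * max a 0 * (u 0 t - b0 t) * (if i = 0 then 1 else 0)
      - \<tau> * min a 0 * (u N t - bN t) * (if i = N then 1 else 0) - a * (\<Sum>j\<le>N. Q i j * u j t)"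
    if "i \<le> N" for i
  proof -
    have "(\<Sum>j\<le>N. M i j * deriv (u j) t) + a * (\<Sum>j\<le>N. Q i j * u j t) =
        \<tau> * max a 0 * (u 0 t - b0 t) * \<phi> i 0 - \<tau> * min a 0 * (u N t - bN t) * \<phi> i 1"
      using sol \<open>0 < t\<close> that unfolding cg_solution_def f0[symmetric] f1[symmetric] by blast
    then show ?thesis unfolding \<phi>0[OF that] \<phi>1[OF that] by linarith
  qed
  \<comment> \<open>Row \<open>i\<close> is multiplied by \<open>u i t\<close> and the rows are
    summed; the penalty terms survive only for \<open>i = 0\<close> and
    \<open>i = N\<close>.\<close>
  have "(\<Sum>i\<le>N. u i t * (\<Sum>j\<le>N. M i j * deriv (u j) t)) =
      (\<Sum>i\<le>N. (if i = 0 then \<tau> * max a 0 * (u 0 t - b0 t) * u 0 t else 0)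
        - (if i = N then \<tau> * min a 0 * (u N t - bN t) * u N t else 0)
        - a * (\<Sum>j\<le>N. u i t * Q i j * u j t))"
    by (intro sum.cong refl) (auto simp: scheme algebra_simps sum_distrib_left)
  also have "\<dots> = \<tau> * max a 0 * (u 0 t - b0 t) * u 0 t - \<tau> * min a 0 * (u N t - bN t) * u N t
      - a * quad_form N Q (\<lambda>j. u j t)"
    by (simp add: sum_subtractf quad_form_def sum_distrib_left)
  finally have test: "(\<Sum>i\<le>N. u i t * (\<Sum>j\<le>N. M i j * deriv (u j) t)) = \<dots>" .
  have "((\<lambda>t. quad_form N M (\<lambda>j. u j t)) has_real_derivative
      2 * (\<Sum>i\<le>N. u i t * (\<Sum>j\<le>N. M i j * deriv (u j) t))) (at t)"
    using sol \<open>0 < t\<close>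
    by (intro quad_form_has_derivative cg_matrices_properties(2)[OF mesh basis mat])
      (auto simp: cg_solution_def field_differentiable_derivI)
  moreover have "2 * quad_form N Q (\<lambda>j. u j t) = (u N t)\<^sup>2 - (u 0 t)\<^sup>2"
    using quad_form_sbp cg_matrices_properties(1)[OF mesh basis mat] \<open>N \<noteq> 0\<close> by simp
  ultimately show ?thesis
    unfolding test by (simp add: right_diff_distrib mult.left_commute[of 2 a])
qed

text \<open>The mean value theorem on \<open>{0..t}\<close> replaces integration of the rate: it
  fits a scheme that holds only for positive times, with continuity at 0 supplying the initial
  energy, and data known only to be bounded.\<close>

lemma energy_growth:
  assumes \<tau>: "\<tau> < - 1 / 2"
    and mesh: "fe_mesh N x m e"
    and basis: "lagrange_basis N x m e \<phi>"
    and mat: "cg_matrices N x m e \<phi> M Q"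
    and sol: "cg_solution a \<tau> N x \<phi> M Q b0 bN u_in u"
    and "0 < t"
    and B: "\<And>s. 0 \<le> s \<Longrightarrow> s \<le> t \<Longrightarrow> \<bar>inflow_datum a b0 bN s\<bar>\<^sup>2 \<le> B"
  shows "quad_form N M (\<lambda>j. u j t)
    \<le> quad_form N M (\<lambda>j. u_in (x j)) + t * (\<bar>a\<bar> * (\<tau>\<^sup>2 / (- (1 + 2 * \<tau>)) * B))"
proof -
  let ?E = "\<lambda>t. quad_form N M (\<lambda>j. u j t)"
  let ?D = "\<lambda>s. 2 * (\<tau> * max a 0 * (u 0 s - b0 s) * u 0 s - \<tau> * min a 0 * (u N s - bN s) * u N s)
    - a * ((u N s)\<^sup>2 - (u 0 s)\<^sup>2)"
  note der = energy_has_derivative[OF mesh basis mat sol]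
  have "continuous_on {0..t} (u j)" if "j \<le> N" for j
    using sol that by (auto simp: cg_solution_def intro: continuous_on_subset)
  then have "continuous_on {0..t} ?E"
    unfolding quad_form_def by (intro continuous_intros) auto
  then obtain l s where s: "0 < s" "s < t" and l: "(?E has_real_derivative l) (at s)"
    and mvt: "?E t - ?E 0 = (t - 0) * l"
    using MVT[OF \<open>0 < t\<close>, of ?E] der unfolding real_differentiable_def by blast
  have "l = ?D s" using DERIV_unique[OF l der[OF s(1)]] .
  have eq: "?E 0 = quad_form N M (\<lambda>j. u_in (x j))"
    using sol by (simp add: quad_form_def cg_solution_def)
  have "(if a > 0 then b0 s else if a < 0 then bN s else 0)\<^sup>2 \<le> B"
    using B[of s] s by (simp add: inflow_datum_def split: if_splits)
  then have "\<bar>a\<bar> * (\<tau>\<^sup>2 / (- (1 + 2 * \<tau>)) * (if a > 0 then b0 s else if a < 0 then bN s else 0)\<^sup>2)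
      \<le> \<bar>a\<bar> * (\<tau>\<^sup>2 / (- (1 + 2 * \<tau>)) * B)"
    using \<tau> by (intro mult_left_mono divide_nonneg_nonneg) auto
  then have "?D s \<le> \<bar>a\<bar> * (\<tau>\<^sup>2 / (- (1 + 2 * \<tau>)) * B)"
    using energy_rate_bound[OF \<tau>] order_trans by blast
  then have "t * ?D s \<le> t * (\<bar>a\<bar> * (\<tau>\<^sup>2 / (- (1 + 2 * \<tau>)) * B))"
    using \<open>0 < t\<close> by (intro mult_left_mono) auto
  then show ?thesis using mvt eq \<open>l = ?D s\<close> by simp
qed

text \<open>The maximum of the squared datum is expressed as a supremum; boundedness makes it a
  genuine upper bound. \<open>K\<close> is chosen before the mesh and the data, hence depends only
  on \<open>a\<close> and \<open>\<tau>\<close>.\<close>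

theorem proposition3p5:
  fixes a \<tau> :: real
  assumes "\<tau> < - 1 / 2"
  shows "\<exists>K :: real \<Rightarrow> real.
    (\<forall>T. bounded (K ` {0..T})) \<and>
    (\<forall>(N :: nat) (x :: nat \<Rightarrow> real) (m :: nat) (e :: nat \<Rightarrow> nat) (\<phi> :: nat \<Rightarrow> real \<Rightarrow> real)
       (M :: nat \<Rightarrow> nat \<Rightarrow> real) (Q :: nat \<Rightarrow> nat \<Rightarrow> real)
       (b0 :: real \<Rightarrow> real) (bN :: real \<Rightarrow> real) (u_in :: real \<Rightarrow> real)
       (u :: nat \<Rightarrow> real \<Rightarrow> real).
       fe_mesh N x m e \<longrightarrow>
       lagrange_basis N x m e \<phi> \<longrightarrow>
       cg_matrices N x m e \<phi> M Q \<longrightarrow>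
       cg_solution a \<tau> N x \<phi> M Q b0 bN u_in u \<longrightarrow>
       (\<forall>t>0. bdd_above ((\<lambda>s. \<bar>inflow_datum a b0 bN s\<bar>\<^sup>2) ` {0..t}) \<longrightarrow>
          quad_form N M (\<lambda>j. u j t)
            \<le> K t * (quad_form N M (\<lambda>j. u_in (x j))
                     + (SUP s\<in>{0..t}. \<bar>inflow_datum a b0 bN s\<bar>\<^sup>2))))"
proof -
  define c where "c = \<bar>a\<bar> * (\<tau>\<^sup>2 / (- (1 + 2 * \<tau>)))"
  have c: "c \<ge> 0"
    unfolding c_def using assms by (intro mult_nonneg_nonneg divide_nonneg_nonneg) auto
  show ?thesis
  \<comment> \<open>The growth estimate gives \<open>E0 + t * c * B\<close>. Expanding
    \<open>(1 + t * c) * (E0 + B)\<close> adds only \<open>B\<close> and \<open>t * c * E0\<close>,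
    both nonnegative.\<close>
  proof (intro exI[of _ "\<lambda>t. 1 + t * c"] conjI allI impI)
    fix T :: real
    have "compact ((\<lambda>t. 1 + t * c) ` {0..T})"
      by (intro compact_continuous_image continuous_intros) simp
    then show "bounded ((\<lambda>t. 1 + t * c) ` {0..T})" by (rule compact_imp_bounded)
  next
    fix N x m e \<phi> M Q b0 bN u_in u and t :: real
    assume mesh: "fe_mesh N x m e" and basis: "lagrange_basis N x m e \<phi>"
      and mat: "cg_matrices N x m e \<phi> M Q"
      and sol: "cg_solution a \<tau> N x \<phi> M Q b0 bN u_in u" and t: "0 < t"
      and bdd: "bdd_above ((\<lambda>s. \<bar>inflow_datum a b0 bN s\<bar>\<^sup>2) ` {0..t})"
    define B where "B = (SUP s\<in>{0..t}. \<bar>inflow_datum a b0 bN s\<bar>\<^sup>2)"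
    define E0 where "E0 = quad_form N M (\<lambda>j. u_in (x j))"
    have B: "\<bar>inflow_datum a b0 bN s\<bar>\<^sup>2 \<le> B" if "0 \<le> s" "s \<le> t" for s
      unfolding B_def using that by (intro cSUP_upper bdd) auto
    have "0 \<le> B" using B[of 0] t by (intro order_trans[OF zero_le_power2]) auto
    moreover have "0 \<le> t * c * E0"
      unfolding E0_def using c t cg_matrices_properties(3)[OF mesh basis mat] by simp
    moreover have "quad_form N M (\<lambda>j. u j t) \<le> E0 + t * c * B"
      using energy_growth[OF assms mesh basis mat sol t B] by (simp add: E0_def c_def)
    ultimately have "quad_form N M (\<lambda>j. u j t) \<le> (1 + t * c) * (E0 + B)"
      by (simp add: algebra_simps)
    then show "quad_form N M (\<lambda>j. u j t)
        \<le> (1 + t * c) * (quad_form N M (\<lambda>j. u_in (x j)) + (SUP s\<in>{0..t}. \<bar>inflow_datum a b0 bN s\<bar>\<^sup>2))"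
      by (simp add: E0_def B_def)
  qed
qed

end
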